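(* Let $u,v$ be two distinct operations in a (possibly multiple-clock) program, let $F$ be the innermost $\mathtt{finish}$ containing both $u$ and $v$, and let $f_u$ (resp. $f_v$) be the outermost $\mathtt{finish}$ strictly inside $F$ that contains $u$ (resp. $v$) if there is one, and $f_u=F$ (resp. $f_v=F$) otherwise. Transform $F$ as follows: if $f_u\neq F$, replace $f_u$ by a new fictitious basic statement $U$, and if $f_u=F$ put $U=u$; likewise, if $f_v\ne F$, replace $f_v$ by a new fictitious basic statement $V$, and if $f_v=F$ put $V=v$. Then $$u\prec\!\!\prec v \ \text{ (in the original program)} \iff U\prec\!\!\prec V\ \text{ (in the transformed } F).$$
   Context: **Programs.** Loops are assumed to have been statically expanded, and the heap is ignored. Statements are $s ::= b \mid \mathtt{advance} \mid \{s\ t\} \mid \mathtt{async}\ s \mid \mathtt{finish}\ s$, where the basic statements $b$ are all treated as $\mathtt{skip}$s carrying pairwise distinct names; the (named) basic statements of a program are its *operations*. Each $\mathtt{finish}$ has its own clock, and each $\mathtt{advance}$ uses the clock of the innermost $\mathtt{finish}$ enclosing it. A program is a statement of the form $\mathtt{finish}\ r$, so every operation and every $\mathtt{advance}$ is enclosed in a $\mathtt{finish}$. **Reduction.** A configuration is a statement or the terminated configuration $\mathtt{done}$. A statement is asynchronous if it is $\mathtt{async}\ s$, or $\{s\ t\}$ with $s$ and $t$ both asynchronous; otherwise it is synchronous. The relation $\longrightarrow$ is generated by: $b\longrightarrow\mathtt{done}$ for each basic statement $b$; if $s\longrightarrow s'$ then $\mathtt{async}\ s\longrightarrow\mathtt{async}\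 s'$, $\mathtt{finish}\ s\longrightarrow\mathtt{finish}\ s'$, $\{s\ t\}\longrightarrow\{s'\ t\}$, and, when $t$ is asynchronous, $\{t\ s\}\longrightarrow\{t\ s'\}$; if $s\longrightarrow\mathtt{done}$ then $\mathtt{async}\ s\longrightarrow\mathtt{done}$, $\mathtt{finish}\ s\longrightarrow\mathtt{done}$, $\{s\ t\}\longrightarrow t$, and, when $t$ is asynchronous, $\{t\ s\}\longrightarrow t$; and the *clock rule*: if $s$ is stuck and $s\Longrightarrow t$ then $\mathtt{finish}\ s\longrightarrow\mathtt{finish}\ t$. "Stuck" is the least predicate such that: $\mathtt{advance}$ is stuck; $\mathtt{async}\ s$ is stuck if $s$ is; $\{s\ t\}$ is stuck if $s$ is synchronous and stuck, or if $s$ is asynchronous and both $s$ and $t$ are stuck. The clock-step relation $\Longrightarrow$ is generated by: $\mathtt{advance}\Longrightarrow\mathtt{skip}$; $b\Longrightarrow b$; if $s\Longrightarrow t$ then $\mathtt{async}\ s\Longrightarrow\mathtt{async}\ t$, and $\{s\ u\}\Longrightarrow\{t\ u\}$ when $s$ is synchronous; if $s$ is asynchronous, $s\Longrightarrow s'$ and $t\Longrightarrow t'$, then $\{s\ t\}\Longrightarrow\{s'\ t'\}$. **Happens-before.** An interpretation of a program is a complete reduction sequence from it to $\mathtt{done}$. For operations $u,v$, $u\prec\!\!\prec v$ iff $u$ is executed before $v$ in every interpretation of the program. *)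

theory Defs
  imports Main
begin

text \<open>
  \<open>Basic (Some a)\<close> is the operation named \<open>a\<close>.  \<open>Basic None\<close> is the unnamed \<open>skip\<close> left behind
  by an \<open>advance\<close> when the clock ticks; it does not occur in programs.
\<close>

datatype (ops: 'a) stmt =
    Basic "'a option"
  | Advance
  | Seq "'a stmt" "'a stmt"
  | Async "'a stmt"
  | is_finish: Finish "'a stmt"

datatype 'a config = Stmt "'a stmt" | Done

fun basics :: "'a stmt \<Rightarrow> 'a option list" where
  "basics (Basic b) = [b]"
| "basics Advance = []"
| "basics (Seq s t) = basics s @ basics t"
| "basics (Async s) = basics s"
| "basics (Finish s) = basics s"

definition program :: "'a stmt \<Rightarrow> bool" where
  "program p \<longleftrightarrow> is_finish p \<and> None \<notin> set (basics p) \<and> distinct (basics p)"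


fun asynchronous :: "'a stmt \<Rightarrow> bool" where
  "asynchronous (Async s) = True"
| "asynchronous (Seq s t) = (asynchronous s \<and> asynchronous t)"
| "asynchronous _ = False"

inductive stuck :: "'a stmt \<Rightarrow> bool" where
  "stuck Advance"
| "stuck s \<Longrightarrow> stuck (Async s)"
| "\<not> asynchronous s \<Longrightarrow> stuck s \<Longrightarrow> stuck (Seq s t)"
| "asynchronous s \<Longrightarrow> stuck s \<Longrightarrow> stuck t \<Longrightarrow> stuck (Seq s t)"

inductive clock_step :: "'a stmt \<Rightarrow> 'a stmt \<Rightarrow> bool" where
  "clock_step Advance (Basic None)"
| "clock_step (Basic b) (Basic b)"
| "clock_step s t \<Longrightarrow> clock_step (Async s) (Async t)"
| "\<not> asynchronous s \<Longrightarrow> clock_step s t \<Longrightarrow> clock_step (Seq s u) (Seq t u)"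
| "asynchronous s \<Longrightarrow> clock_step s s' \<Longrightarrow> clock_step t t' \<Longrightarrow> clock_step (Seq s t) (Seq s' t')"

text \<open>
  The reduction relation, decorated with the operation executed by the step: \<open>red s (Some a) c\<close>
  if the step executes the operation \<open>a\<close>, and \<open>red s None c\<close> if it executes an unnamed \<open>skip\<close> or
  is an instance of the clock rule.
\<close>

inductive red :: "'a stmt \<Rightarrow> 'a option \<Rightarrow> 'a config \<Rightarrow> bool" where
  basic: "red (Basic b) b Done"
| async: "red s l (Stmt s') \<Longrightarrow> red (Async s) l (Stmt (Async s'))"
| finish: "red s l (Stmt s') \<Longrightarrow> red (Finish s) l (Stmt (Finish s'))"
| seq_left: "red s l (Stmt s') \<Longrightarrow> red (Seq s t) l (Stmt (Seq s' t))"
| seq_right: "asynchronous t \<Longrightarrow> red s l (Stmt s') \<Longrightarrow> red (Seq t s) l (Stmt (Seq t s'))"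
| async_done: "red s l Done \<Longrightarrow> red (Async s) l Done"
| finish_done: "red s l Done \<Longrightarrow> red (Finish s) l Done"
| seq_left_done: "red s l Done \<Longrightarrow> red (Seq s t) l (Stmt t)"
| seq_right_done: "asynchronous t \<Longrightarrow> red s l Done \<Longrightarrow> red (Seq t s) l (Stmt t)"
| clock: "stuck s \<Longrightarrow> clock_step s t \<Longrightarrow> red (Finish s) None (Stmt (Finish t))"


text \<open>
  \<open>interpretation_of c ls\<close>: some complete reduction sequence leads from \<open>c\<close> to \<open>Done\<close>, and
  \<open>ls\<close> lists what its successive steps execute.
\<close>

inductive interpretation_of :: "'a config \<Rightarrow> 'a option list \<Rightarrow> bool" where
  "interpretation_of Done []"
| "red s l c \<Longrightarrow> interpretation_of c ls \<Longrightarrow> interpretation_of (Stmt s) (l # ls)"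

definition executed_before :: "'a \<Rightarrow> 'a \<Rightarrow> 'a option list \<Rightarrow> bool" where
  "executed_before u v ls \<longleftrightarrow>
     (\<exists>i j. i < j \<and> j < length ls \<and> ls ! i = Some u \<and> ls ! j = Some v)"

definition happens_before :: "'a stmt \<Rightarrow> 'a \<Rightarrow> 'a \<Rightarrow> bool" where
  "happens_before p u v \<longleftrightarrow> (\<forall>ls. interpretation_of (Stmt p) ls \<longrightarrow> executed_before u v ls)"


text \<open>
  Names in a program are pairwise distinct, so a substatement containing an operation occurs only
  once and may be identified with its occurrence.
\<close>

fun substmts :: "'a stmt \<Rightarrow> 'a stmt set" where
  "substmts (Basic b) = {Basic b}"
| "substmts Advance = {Advance}"
| "substmts (Seq s t) = insert (Seq s t) (substmts s \<union> substmts t)"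
| "substmts (Async s) = insert (Async s) (substmts s)"
| "substmts (Finish s) = insert (Finish s) (substmts s)"

definition finishes :: "'a stmt \<Rightarrow> 'a stmt set" where
  "finishes s = {f \<in> substmts s. is_finish f}"

definition innermost_finish :: "'a stmt \<Rightarrow> 'a \<Rightarrow> 'a \<Rightarrow> 'a stmt \<Rightarrow> bool" where
  "innermost_finish p u v F \<longleftrightarrow>
     F \<in> finishes p \<and> u \<in> ops F \<and> v \<in> ops F \<and>
     (\<forall>G \<in> finishes F. u \<in> ops G \<and> v \<in> ops G \<longrightarrow> G = F)"

definition inner_finishes :: "'a stmt \<Rightarrow> 'a \<Rightarrow> 'a stmt set" where
  "inner_finishes F u = {f \<in> finishes F. f \<noteq> F \<and> u \<in> ops f}"

definition outermost_inner_finish :: "'a stmt \<Rightarrow> 'a \<Rightarrow> 'a stmt \<Rightarrow> bool" where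
  "outermost_inner_finish F u f \<longleftrightarrow>
     (if inner_finishes F u = {} then f = F
      else f \<in> inner_finishes F u \<and> (\<forall>g \<in> inner_finishes F u. g \<in> substmts f))"

fun replace :: "'a stmt \<Rightarrow> 'a \<Rightarrow> 'a stmt \<Rightarrow> 'a stmt" where
  "replace f a s =
     (if s = f then Basic (Some a)
      else case s of
        Seq t t' \<Rightarrow> Seq (replace f a t) (replace f a t')
      | Async t \<Rightarrow> Async (replace f a t)
      | Finish t \<Rightarrow> Finish (replace f a t)
      | _ \<Rightarrow> s)"

declare replace.simps [simp del]

definition replace_inner :: "'a stmt \<Rightarrow> 'a stmt \<Rightarrow> 'a \<Rightarrow> 'a stmt \<Rightarrow> 'a stmt" where
  "replace_inner F f a s = (if f = F then s else replace f a s)"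

end

(*
  A finish is never stuck and never asynchronous, so the context C of a finish f takes the same steps
  whatever f contains.  While f is active, no finish around it can tick, and hence the steps of C
  interleaved with those of f remain possible when f is run to its end at once.  A run of C[f]
  thus yields a run of f alone and runs of C with f contracted to a single step, placed at its first
  or at its last step; conversely, any run of f can be inserted in a run of C at the place where
  the contracted step is executed.  The former settles the passage from the program to F, the latter
  the replacement of f_u and f_v.
*)

theory Submission
  imports Defs
begin

section \<open>Reduction\<close>

text \<open>\<open>seq_l\<close>, \<open>seq_r\<close> and \<open>map_config\<close> lift the
  constructors to configurations, with \<open>Done\<close> absorbed as in the \<open>_done\<close>
  rules. Each constructor's pair of rules then merges into one equivalence.\<close>

fun seq_l :: "'a config \<Rightarrow> 'a stmt \<Rightarrow> 'a config" where
  "seq_l (Stmt s) t = Stmt (Seq s t)"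
| "seq_l Done t = Stmt t"

fun seq_r :: "'a stmt \<Rightarrow> 'a config \<Rightarrow> 'a config" where
  "seq_r s (Stmt t) = Stmt (Seq s t)"
| "seq_r s Done = Stmt s"

fun map_config :: "('a stmt \<Rightarrow> 'a stmt) \<Rightarrow> 'a config \<Rightarrow> 'a config" where
  "map_config k (Stmt s) = Stmt (k s)"
| "map_config k Done = Done"

lemma map_config_eq_Stmt:
  "map_config k c = Stmt s \<longleftrightarrow> (\<exists>t. c = Stmt t \<and> s = k t)"
  "Stmt s = map_config k c \<longleftrightarrow> (\<exists>t. c = Stmt t \<and> s = k t)"
  by (cases c; auto)+

lemma red_Basic_iff: "red (Basic b) l c \<longleftrightarrow> l = b \<and> c = Done"
  by (auto intro: red.intros elim: red.cases)

lemma red_Async_iff: "red (Async s) l c \<longleftrightarrow> (\<exists>c'. red s l c' \<and> c = map_config Async c')"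
proof
  show "red (Async s) l c \<Longrightarrow> \<exists>c'. red s l c' \<and> c = map_config Async c'"
    by (erule red.cases; simp; metis map_config.simps)
next
  assume "\<exists>c'. red s l c' \<and> c = map_config Async c'"
  then obtain c' where "red s l c'" "c = map_config Async c'" by blast
  then show "red (Async s) l c" by (cases c') (auto intro: red.intros)
qed

lemma red_Finish_iff:
  "red (Finish s) l c \<longleftrightarrow> (\<exists>c'. red s l c' \<and> c = map_config Finish c') \<or>
     l = None \<and> stuck s \<and> (\<exists>t. clock_step s t \<and> c = Stmt (Finish t))" (is "_ \<longleftrightarrow> ?inner \<or> ?tick")
proof
  show "red (Finish s) l c \<Longrightarrow> ?inner \<or> ?tick"
    by (erule red.cases; simp; metis map_config.simps)
next
  assume "?inner \<or> ?tick"
  then show "red (Finish s) l c"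
  proof
    assume ?inner
    then obtain c' where "red s l c'" "c = map_config Finish c'" by blast
    then show ?thesis by (cases c') (auto intro: red.intros)
  qed (auto intro: red.intros)
qed

lemma red_Seq_iff:
  "red (Seq s t) l c \<longleftrightarrow> (\<exists>c'. red s l c' \<and> c = seq_l c' t) \<or>
     asynchronous s \<and> (\<exists>c'. red t l c' \<and> c = seq_r s c')" (is "_ \<longleftrightarrow> ?left \<or> ?right")
proof
  show "red (Seq s t) l c \<Longrightarrow> ?left \<or> ?right"
    by (erule red.cases; simp; metis seq_l.simps seq_r.simps)
next
  assume "?left \<or> ?right"
  then show "red (Seq s t) l c"
  proof
    assume ?left
    then obtain c' where "red s l c'" "c = seq_l c' t" by blast
    then show ?thesis by (cases c') (auto intro: red.intros)
  next
    assume ?right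
    then obtain c' where "asynchronous s" "red t l c'" "c = seq_r s c'" by blast
    then show ?thesis by (cases c') (auto intro: red.intros)
  qed
qed

lemmas red_iff = red_Basic_iff red_Async_iff red_Finish_iff red_Seq_iff

section \<open>Stuckness, progress and termination\<close>

lemma stuck_simps [simp]:
  "\<not> stuck (Basic b)"
  "stuck Advance"
  "stuck (Async s) \<longleftrightarrow> stuck s"
  "\<not> stuck (Finish s)"
  "stuck (Seq s t) \<longleftrightarrow> stuck s \<and> (asynchronous s \<longrightarrow> stuck t)"
  by (auto intro: stuck.intros elim: stuck.cases)

lemma clock_step_iff:
  "clock_step Advance s' \<longleftrightarrow> s' = Basic None"
  "clock_step (Async s) s' \<longleftrightarrow> (\<exists>t. clock_step s t \<and> s' = Async t)"
  "\<not> clock_step (Finish s) s'"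
  "clock_step (Seq s t) s' \<longleftrightarrow> (\<exists>s1 t1. s' = Seq s1 t1 \<and> clock_step s s1 \<and>
     (if asynchronous s then clock_step t t1 else t1 = t))"
  by (auto intro: clock_step.intros elim: clock_step.cases)

lemma stuck_clock_step_exists: "stuck s \<Longrightarrow> \<exists>t. clock_step s t"
  by (induction rule: stuck.induct) (auto simp: clock_step_iff)

text \<open>Progress. In a \<open>Seq\<close> that is not stuck, the left part can move, or it is
  asynchronous and the right part can move. A \<open>Finish\<close> with a stuck body moves by the
  clock rule.\<close>

lemma not_stuck_red: "\<not> stuck s \<Longrightarrow> \<exists>l c. red s l c"
proof (induction s)
  case (Basic b)
  then show ?case using red_Basic_iff by blast
next
  case (Seq s t)
  then show ?case unfolding red_Seq_iff stuck_simps by blast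
next
  case (Async s)
  then show ?case unfolding red_Async_iff stuck_simps by blast
next
  case (Finish s)
  then show ?case
    by (cases "stuck s") (use red_Finish_iff stuck_clock_step_exists in \<open>metis+\<close>)
qed simp

text \<open>An \<open>Advance\<close> weighs more than the \<open>skip\<close> replacing it, so clock steps decrease the weight too.\<close>

fun weight :: "'a stmt \<Rightarrow> nat" where
  "weight (Basic b) = 1"
| "weight Advance = 2"
| "weight (Seq s t) = weight s + weight t + 1"
| "weight (Async s) = weight s + 1"
| "weight (Finish s) = weight s + 1"

text \<open>Stuckness makes the decrease strict: by itself, \<open>Basic b\<close> ticks to
  \<open>Basic b\<close> without losing weight.\<close>

lemma clock_step_weight: "stuck s \<Longrightarrow> clock_step s t \<Longrightarrow> weight t < weight s"
  by (induction s arbitrary: t) (auto simp: clock_step_iff add_less_mono split: if_splits)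

lemma red_weight: "red s l (Stmt s') \<Longrightarrow> weight s' < weight s"
  by (induction s l "Stmt s'" arbitrary: s' rule: red.induct) (auto dest: clock_step_weight)

lemma red_is_finish: "red s l (Stmt s') \<Longrightarrow> is_finish s \<Longrightarrow> is_finish s'"
  by (cases s) (auto simp: red_iff map_config_eq_Stmt)

text \<open>Being a \<open>Finish\<close> is invariant under steps and excludes stuckness, so a step
  exists until \<open>Done\<close> is reached; the weight bounds their number. This provides a
  sample run wherever one must be chosen.\<close>

lemma interpretation_exists:
  assumes "is_finish s" shows "\<exists>ls. interpretation_of (Stmt s) ls"
  using assms
proof (induction "weight s" arbitrary: s rule: less_induct)
  case less
  then have "\<not> stuck s" by (cases s) auto
  then obtain l c where red: "red s l c" using not_stuck_red by blast
  have "\<exists>ls. interpretation_of c ls"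
    using less red by (cases c) (auto intro: interpretation_of.intros dest: red_weight red_is_finish)
  with red show ?case by (auto intro: interpretation_of.intros)
qed

section \<open>Operation names along reductions\<close>

fun config_basics :: "'a config \<Rightarrow> 'a option list" where
  "config_basics (Stmt s) = basics s"
| "config_basics Done = []"

text \<open>A tick only turns \<open>Advance\<close>, which lists nothing, into an unnamed skip;
  hence the allowance for \<open>None\<close> here and in the bounds that follow.\<close>

lemma clock_step_basics:
  "clock_step s t \<Longrightarrow> set (basics s) \<subseteq> set (basics t) \<and> set (basics t) \<subseteq> insert None (set (basics s))"
  by (induction rule: clock_step.induct) auto

lemma red_basics:
  "red s l c \<Longrightarrow> l \<in> insert None (set (basics s)) \<and> set (basics s) \<subseteq> insert l (set (config_basics c))
     \<and> set (config_basics c) \<subseteq> insert None (set (basics s))"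
  by (induction rule: red.induct) (auto dest: clock_step_basics)

lemma interpretation_basics:
  "interpretation_of c ls \<Longrightarrow>
     set ls \<subseteq> insert None (set (config_basics c)) \<and> set (config_basics c) \<subseteq> set ls"
  by (induction rule: interpretation_of.induct) (fastforce dest: red_basics)+

lemma interpretation_Done [simp]: "interpretation_of Done ls \<longleftrightarrow> ls = []"
  by (auto intro: interpretation_of.intros elim: interpretation_of.cases)

lemma interpretation_Stmt:
  "interpretation_of (Stmt s) ls \<longleftrightarrow> (\<exists>l c ms. ls = l # ms \<and> red s l c \<and> interpretation_of c ms)"
  by (subst interpretation_of.simps) auto

lemma ops_iff_basics: "a \<in> ops s \<longleftrightarrow> Some a \<in> set (basics s)"
proof (induction s)
  case (Basic b)
  then show ?case by (cases b) auto
qed auto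

section \<open>Contexts\<close>

text \<open>One-hole contexts. The hole may also lie behind a synchronous statement, where its
  content has to wait.\<close>

datatype 'a ctx =
    Hole
  | Seq_L "'a ctx" "'a stmt"
  | Seq_R "'a stmt" "'a ctx"
  | Async_C "'a ctx"
  | Finish_C "'a ctx"

fun plug :: "'a ctx \<Rightarrow> 'a stmt \<Rightarrow> 'a stmt" where
  "plug Hole f = f"
| "plug (Seq_L C t) f = Seq (plug C f) t"
| "plug (Seq_R s C) f = Seq s (plug C f)"
| "plug (Async_C C) f = Async (plug C f)"
| "plug (Finish_C C) f = Finish (plug C f)"

text \<open>What becomes of the context once its content has reached a configuration: at
  \<open>Done\<close> the constructors around the hole collapse as in the \<open>_done\<close>
  rules.\<close>

fun fill :: "'a ctx \<Rightarrow> 'a config \<Rightarrow> 'a config" where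
  "fill Hole c = c"
| "fill (Seq_L C t) c = seq_l (fill C c) t"
| "fill (Seq_R s C) c = seq_r s (fill C c)"
| "fill (Async_C C) c = map_config Async (fill C c)"
| "fill (Finish_C C) c = map_config Finish (fill C c)"

text \<open>Positions at which a step of the content is a step of the whole: everything composed in
  front of the hole is asynchronous.\<close>

fun active :: "'a ctx \<Rightarrow> bool" where
  "active Hole = True"
| "active (Seq_L C t) = active C"
| "active (Seq_R s C) = (asynchronous s \<and> active C)"
| "active (Async_C C) = active C"
| "active (Finish_C C) = active C"

fun ctx_basics :: "'a ctx \<Rightarrow> 'a option list" where
  "ctx_basics Hole = []"
| "ctx_basics (Seq_L C t) = ctx_basics C @ basics t"
| "ctx_basics (Seq_R s C) = basics s @ ctx_basics C"
| "ctx_basics (Async_C C) = ctx_basics C"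
| "ctx_basics (Finish_C C) = ctx_basics C"

text \<open>Statements that are neither asynchronous nor ever stuck.\<close>

fun solid :: "'a stmt \<Rightarrow> bool" where
  "solid (Basic b) = True"
| "solid (Finish s) = True"
| "solid _ = False"

lemma fill_Stmt [simp]: "fill C (Stmt f) = Stmt (plug C f)"
  by (induction C) auto

lemma set_basics_plug: "set (basics (plug C f)) = set (ctx_basics C) \<union> set (basics f)"
  by (induction C) auto

lemma distinct_basics_plug:
  "distinct (basics (plug C f)) \<longleftrightarrow> distinct (ctx_basics C) \<and> distinct (basics f) \<and>
     set (ctx_basics C) \<inter> set (basics f) = {}"
  by (induction C) (auto simp: set_basics_plug)

lemma basics_seq_l: "set (config_basics (seq_l c t)) = set (config_basics c) \<union> set (basics t)"
  by (cases c) auto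

lemma basics_seq_r: "set (config_basics (seq_r s c)) = set (config_basics c) \<union> set (basics s)"
  by (cases c) auto

lemma basics_fill_Done: "set (config_basics (fill C Done)) \<subseteq> set (ctx_basics C)"
proof (induction C)
  case (Async_C C) then show ?case by (cases "fill C Done") auto
next
  case (Finish_C C) then show ?case by (cases "fill C Done") auto
qed (auto simp: basics_seq_l basics_seq_r)

lemma red_fill: "active C \<Longrightarrow> red f l c \<Longrightarrow> red (plug C f) l (fill C c)"
  by (induction C) (auto simp: red_iff)

lemma red_solid: "red f l (Stmt f') \<Longrightarrow> solid f \<Longrightarrow> solid f'"
  by (cases f) (auto simp: red_iff map_config_eq_Stmt)

text \<open>Solid statements are all synchronous, so the side conditions of the rules depend on the
  context alone and survive an exchange of the content.\<close>

lemma asynchronous_plug: "solid f \<Longrightarrow> solid g \<Longrightarrow> asynchronous (plug C f) \<longleftrightarrow> asynchronous (plug C g)"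
proof (induction C)
  case Hole then show ?case by (cases f; cases g) auto
qed auto

text \<open>Keeps the side condition of \<open>seq_right\<close> valid after the hole has
  terminated, so that a statement to the right of the context can still move.\<close>

lemma asynchronous_fill_Done:
  "asynchronous (plug C f) \<Longrightarrow> solid f \<Longrightarrow> fill C Done = Stmt s \<Longrightarrow> asynchronous s"
proof (induction C arbitrary: s)
  case (Seq_L C t) then show ?case by (cases "fill C Done") auto
next
  case (Seq_R t C) then show ?case by (cases "fill C Done") auto
qed (auto simp: map_config_eq_Stmt)

lemma stuck_plug: "stuck (plug C f) \<Longrightarrow> solid f \<Longrightarrow> solid g \<Longrightarrow> stuck (plug C g)"
proof (induction C)
  case Hole then show ?case by (cases f) auto
qed (auto dest: asynchronous_plug)

text \<open>Stuckness requires every part that could run to be stuck; a solid content never is, nor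
  is a \<open>Finish\<close> around it.\<close>

lemma active_not_stuck: "active C \<Longrightarrow> solid f \<Longrightarrow> \<not> stuck (plug C f)"
proof (induction C)
  case Hole then show ?case by (cases f) auto
qed auto

text \<open>In a stuck statement the solid content lies behind a synchronous stuck part, where a
  clock step copies it unchanged; so the same tick is available for any other solid content.\<close>

lemma clock_step_plug:
  "stuck (plug C f) \<Longrightarrow> clock_step (plug C f) t \<Longrightarrow> solid f \<Longrightarrow>
   \<exists>C'. t = plug C' f \<and> (\<forall>g. solid g \<longrightarrow> clock_step (plug C g) (plug C' g)) \<and>
     set (ctx_basics C') \<subseteq> insert None (set (ctx_basics C))"
proof (induction C arbitrary: t)
  case Hole
  then show ?case by (cases f) auto
next
  case (Seq_L C s)
  from Seq_L.prems obtain t1 s1 where t: "t = Seq t1 s1" "clock_step (plug C f) t1"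
    "if asynchronous (plug C f) then clock_step s s1 else s1 = s" "stuck (plug C f)"
    by (auto simp: clock_step_iff)
  from Seq_L.IH[OF t(4,2) Seq_L.prems(3)] obtain C' where C': "t1 = plug C' f"
    "\<forall>g. solid g \<longrightarrow> clock_step (plug C g) (plug C' g)"
    "set (ctx_basics C') \<subseteq> insert None (set (ctx_basics C))" by blast
  have "set (basics s1) \<subseteq> insert None (set (basics s))"
    using t(3) by (auto split: if_splits dest: clock_step_basics)
  with t C' Seq_L.prems(3) show ?case
    by (intro exI[of _ "Seq_L C' s1"])
      (auto simp: clock_step_iff split: if_splits dest: asynchronous_plug)
next
  case (Seq_R s C)
  from Seq_R.prems obtain t1 s1 where t: "t = Seq s1 t1" "clock_step s s1"
    "if asynchronous s then clock_step (plug C f) t1 else t1 = plug C f"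
    "asynchronous s \<longrightarrow> stuck (plug C f)"
    by (auto simp: clock_step_iff)
  have s1: "set (basics s1) \<subseteq> insert None (set (basics s))"
    using t(2) by (auto dest: clock_step_basics)
  show ?case
  proof (cases "asynchronous s")
    case True
    with t Seq_R.IH[of t1] Seq_R.prems(3) obtain C' where C': "t1 = plug C' f"
      "\<forall>g. solid g \<longrightarrow> clock_step (plug C g) (plug C' g)"
      "set (ctx_basics C') \<subseteq> insert None (set (ctx_basics C))" by auto
    with t True s1 show ?thesis
      by (intro exI[of _ "Seq_R s1 C'"]) (auto simp: clock_step_iff)
  next
    \<comment> \<open>The left part is synchronous, so the tick does not reach \<open>C\<close> at
      all.\<close>
    case False
    with t s1 show ?thesis
      by (intro exI[of _ "Seq_R s1 C"]) (auto simp: clock_step_iff)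
  qed
next
  case (Async_C C)
  then obtain t1 where t: "t = Async t1" "clock_step (plug C f) t1" "stuck (plug C f)"
    by (auto simp: clock_step_iff)
  from Async_C.IH[OF t(3,2) Async_C.prems(3)] obtain C' where "t1 = plug C' f"
    "\<forall>g. solid g \<longrightarrow> clock_step (plug C g) (plug C' g)"
    "set (ctx_basics C') \<subseteq> insert None (set (ctx_basics C))" by blast
  with t show ?case
    by (intro exI[of _ "Async_C C'"]) (auto simp: clock_step_iff)
next
  case (Finish_C C)
  then show ?case by simp
qed

text \<open>
  A step outside the hole, whatever solid statement is in it.  If the hole is active, then no
  \<open>Finish\<close> around it can tick, so the step is also possible once the hole has terminated.
\<close>

definition ctx_step :: "'a ctx \<Rightarrow> 'a option \<Rightarrow> 'a ctx \<Rightarrow> bool" where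
  "ctx_step C l C' \<longleftrightarrow>
     (\<forall>g. solid g \<longrightarrow> red (plug C g) l (Stmt (plug C' g))) \<and>
     (active C \<longrightarrow> active C' \<and> (\<exists>s. fill C Done = Stmt s \<and> red s l (fill C' Done))) \<and>
     l \<in> insert None (set (ctx_basics C)) \<and>
     set (ctx_basics C') \<subseteq> insert None (set (ctx_basics C))"

lemma ctx_step_Seq_L: "ctx_step C l C' \<Longrightarrow> ctx_step (Seq_L C t) l (Seq_L C' t)"
  unfolding ctx_step_def by (auto simp: red_Seq_iff intro: seq_l.simps[symmetric])

lemma ctx_step_Seq_R: "asynchronous s \<Longrightarrow> ctx_step C l C' \<Longrightarrow> ctx_step (Seq_R s C) l (Seq_R s C')"
  unfolding ctx_step_def by (auto simp: red_Seq_iff intro: seq_r.simps[symmetric])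

lemma ctx_step_Async: "ctx_step C l C' \<Longrightarrow> ctx_step (Async_C C) l (Async_C C')"
  unfolding ctx_step_def by (auto simp: red_Async_iff intro: map_config.simps[symmetric])

lemma ctx_step_Finish: "ctx_step C l C' \<Longrightarrow> ctx_step (Finish_C C) l (Finish_C C')"
  unfolding ctx_step_def by (auto simp: red_Finish_iff intro: map_config.simps[symmetric])

text \<open>A tick forces the hole to be inactive, which makes the clause of \<open>ctx_step\<close>
  on active holes vacuous.\<close>

lemma ctx_step_clock:
  assumes "stuck (plug C f)" "clock_step (plug C f) t" "solid f"
  shows "\<exists>C'. t = plug C' f \<and> ctx_step (Finish_C C) None (Finish_C C')"
proof -
  obtain C' where C': "t = plug C' f" "\<forall>g. solid g \<longrightarrow> clock_step (plug C g) (plug C' g)"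
    "set (ctx_basics C') \<subseteq> insert None (set (ctx_basics C))"
    using clock_step_plug[OF assms] by blast
  have "\<not> active C" using active_not_stuck assms by blast
  moreover have "red (Finish (plug C g)) None (Stmt (Finish (plug C' g)))" if "solid g" for g
    using stuck_plug[OF assms(1,3) that] C'(2) that by (blast intro: red.clock)
  ultimately show ?thesis using C' unfolding ctx_step_def by auto
qed

lemma red_asynchronous: "red s l (Stmt s') \<Longrightarrow> asynchronous s \<Longrightarrow> asynchronous s'"
  by (induction s l "Stmt s'" arbitrary: s' rule: red.induct) auto

lemma ctx_step_Seq_L_right:
  assumes async: "asynchronous (plug C f)" and "solid f" and red: "red t l c"
  shows "\<exists>C'. seq_r (plug C f) c = Stmt (plug C' f) \<and> ctx_step (Seq_L C t) l C'"
proof -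
  \<comment> \<open>If \<open>t\<close> terminates, the \<open>Seq\<close> disappears and
    \<open>C\<close> alone is left around the hole.\<close>
  define C' where "C' = (case c of Stmt t' \<Rightarrow> Seq_L C t' | Done \<Rightarrow> C)"
  have plug: "Stmt (plug C' g) = seq_r (plug C g) c" for g
    by (cases c) (auto simp: C'_def)
  have "red (plug (Seq_L C t) g) l (Stmt (plug C' g))" if "solid g" for g
    using asynchronous_plug[OF \<open>solid f\<close> that, of C] async red by (auto simp: plug red_Seq_iff)
  moreover have "active C' = active C"
    by (cases c) (auto simp: C'_def)
  moreover have "\<exists>s. fill (Seq_L C t) Done = Stmt s \<and> red s l (fill C' Done)"
  proof (cases "fill C Done")
    case (Stmt s)
    then have "asynchronous s" using asynchronous_fill_Done async \<open>solid f\<close> by blast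
    moreover have "fill C' Done = seq_r s c" using Stmt by (cases c) (auto simp: C'_def)
    ultimately show ?thesis using Stmt red by (auto simp: red_Seq_iff)
  next
    \<comment> \<open>The context \<open>C\<close> vanishes together with its content, so
      \<open>t\<close> is all that remains and moves on its own.\<close>
    case Done
    moreover from this have "fill C' Done = c" by (cases c) (auto simp: C'_def)
    ultimately show ?thesis using red by simp
  qed
  moreover have "set (ctx_basics C') \<subseteq> insert None (set (ctx_basics (Seq_L C t)))"
    using red_basics[OF red] by (cases c) (auto simp: C'_def)
  moreover have "l \<in> insert None (set (ctx_basics (Seq_L C t)))"
    using red_basics[OF red] by auto
  ultimately show ?thesis using plug unfolding ctx_step_def
    by (intro exI[of _ C']) auto
qed

text \<open>Counterpart of \<open>ctx_step_Seq_L_right\<close>; an active hole stays active because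
  the sibling remains asynchronous or vanishes.\<close>

lemma ctx_step_Seq_R_left:
  assumes red: "red s l c"
  shows "\<exists>C'. seq_l c (plug C f) = Stmt (plug C' f) \<and> ctx_step (Seq_R s C) l C'"
proof -
  define C' where "C' = (case c of Stmt s' \<Rightarrow> Seq_R s' C | Done \<Rightarrow> C)"
  have plug: "Stmt (plug C' g) = seq_l c (plug C g)" for g
    by (cases c) (auto simp: C'_def)
  have "red (plug (Seq_R s C) g) l (Stmt (plug C' g))" for g
    using red by (auto simp: plug red_Seq_iff)
  moreover have "active C'" if "active (Seq_R s C)"
    using that red by (cases c) (auto simp: C'_def dest: red_asynchronous)
  moreover have "\<exists>w. fill (Seq_R s C) Done = Stmt w \<and> red w l (fill C' Done)"
  proof (cases "fill C Done")
    case (Stmt w)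
    moreover from this have "fill C' Done = seq_l c w" by (cases c) (auto simp: C'_def)
    ultimately show ?thesis using red by (auto simp: red_Seq_iff)
  next
    case Done
    moreover from this have "fill C' Done = c" by (cases c) (auto simp: C'_def)
    ultimately show ?thesis using red by simp
  qed
  moreover have "set (ctx_basics C') \<subseteq> insert None (set (ctx_basics (Seq_R s C)))"
    using red_basics[OF red] by (cases c) (auto simp: C'_def)
  moreover have "l \<in> insert None (set (ctx_basics (Seq_R s C)))"
    using red_basics[OF red] by auto
  ultimately show ?thesis using plug unfolding ctx_step_def
    by (intro exI[of _ C']) auto
qed

text \<open>Besides steps of the content and steps beside the hole there are only ticks of a
  \<open>Finish\<close> around it, and these pass over the solid content.\<close>

lemma red_plug_cases:
  assumes "red (plug C f) l c" "solid f"
  shows "active C \<and> (\<exists>c'. red f l c' \<and> c = fill C c') \<or>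
    (\<exists>C'. c = Stmt (plug C' f) \<and> ctx_step C l C')"
  using assms
proof (induction C arbitrary: c)
  case Hole
  then show ?case by auto
next
  case (Seq_L C t)
  from Seq_L.prems consider (left) c' where "red (plug C f) l c'" "c = seq_l c' t"
    | (right) c' where "asynchronous (plug C f)" "red t l c'" "c = seq_r (plug C f) c'"
    by (auto simp: red_Seq_iff)
  then show ?case
  proof cases
    case left
    from Seq_L.IH[OF left(1) Seq_L.prems(2)] left(2) show ?thesis
      by (metis active.simps(2) fill.simps(2) plug.simps(2) seq_l.simps(1) ctx_step_Seq_L)
  next
    case right
    with ctx_step_Seq_L_right[OF right(1) Seq_L.prems(2) right(2)] show ?thesis by simp
  qed
next
  case (Seq_R s C)
  from Seq_R.prems consider (left) c' where "red s l c'" "c = seq_l c' (plug C f)"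
    | (right) c' where "asynchronous s" "red (plug C f) l c'" "c = seq_r s c'"
    by (auto simp: red_Seq_iff)
  then show ?case
  proof cases
    case left
    with ctx_step_Seq_R_left[OF left(1), of C f] show ?thesis by simp
  next
    case right
    from Seq_R.IH[OF right(2) Seq_R.prems(2)] right(1,3) show ?thesis
      by (metis active.simps(3) fill.simps(3) plug.simps(3) seq_r.simps(1) ctx_step_Seq_R)
  qed
next
  case (Async_C C)
  then obtain c' where c': "red (plug C f) l c'" "c = map_config Async c'"
    by (auto simp: red_Async_iff)
  from Async_C.IH[OF c'(1) Async_C.prems(2)] c'(2) show ?case
    by (metis active.simps(4) fill.simps(4) plug.simps(4) map_config.simps(1) ctx_step_Async)
next
  case (Finish_C C)
  from Finish_C.prems consider (inner) c' where "red (plug C f) l c'" "c = map_config Finish c'"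
    | (tick) t where "l = None" "stuck (plug C f)" "clock_step (plug C f) t" "c = Stmt (Finish t)"
    by (auto simp: red_Finish_iff)
  then show ?case
  proof cases
    case inner
    from Finish_C.IH[OF inner(1) Finish_C.prems(2)] inner(2) show ?thesis
      by (metis active.simps(5) fill.simps(5) plug.simps(5) map_config.simps(1) ctx_step_Finish)
  next
    case tick
    with ctx_step_clock[OF tick(2,3) Finish_C.prems(2)] show ?thesis by auto
  qed
qed

section \<open>Interpretations of a plugged context\<close>

text \<open>Records a sequence of context steps by its use alone: it may precede any later
  interpretation, for every solid content at once. This is what permits exchanging the content of a
  run.\<close>

definition ctx_path :: "'a ctx \<Rightarrow> 'a option list \<Rightarrow> 'a ctx \<Rightarrow> bool" where
  "ctx_path C ls C' \<longleftrightarrow>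
     (\<forall>g ms. solid g \<longrightarrow> interpretation_of (Stmt (plug C' g)) ms \<longrightarrow>
        interpretation_of (Stmt (plug C g)) (ls @ ms)) \<and>
     set ls \<subseteq> insert None (set (ctx_basics C)) \<and>
     set (ctx_basics C') \<subseteq> insert None (set (ctx_basics C))"

lemma ctx_path_Nil: "ctx_path C [] C"
  unfolding ctx_path_def by auto

lemma ctx_path_Cons:
  assumes step: "ctx_step C l C1" and path: "ctx_path C1 ls C'"
  shows "ctx_path C (l # ls) C'"
proof -
  have "interpretation_of (Stmt (plug C g)) ((l # ls) @ ms)"
    if "solid g" "interpretation_of (Stmt (plug C' g)) ms" for g ms
    using that step path unfolding ctx_step_def ctx_path_def by (auto intro: interpretation_of.intros)
  moreover have "set (l # ls) \<subseteq> insert None (set (ctx_basics C))"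
    and "set (ctx_basics C') \<subseteq> insert None (set (ctx_basics C))"
    using step path unfolding ctx_step_def ctx_path_def by auto
  ultimately show ?thesis unfolding ctx_path_def by blast
qed

text \<open>The run ends in \<open>Done\<close>, so the content must move at some time; all steps
  before that are context steps.\<close>

lemma interpretation_first_step:
  assumes "interpretation_of (Stmt (plug C f)) ls" "solid f"
  shows "\<exists>pre l c ms C'. ls = pre @ l # ms \<and> ctx_path C pre C' \<and> active C' \<and> red f l c \<and>
    interpretation_of (fill C' c) ms"
  using assms
proof (induction ls arbitrary: C rule: list.induct)
  case Nil
  then show ?case by (simp add: interpretation_Stmt)
next
  case (Cons l ls)
  then obtain c where c: "red (plug C f) l c" "interpretation_of c ls"
    by (auto simp: interpretation_Stmt)
  from red_plug_cases[OF c(1) \<open>solid f\<close>] show ?case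
  proof (elim disjE conjE exE)
    fix c' assume "active C" "red f l c'" "c = fill C c'"
    with c(2) ctx_path_Nil show ?thesis by (metis append_Nil)
  next
    fix C1 assume C1: "c = Stmt (plug C1 f)" "ctx_step C l C1"
    from Cons.IH[OF c(2)[unfolded C1] \<open>solid f\<close>] obtain pre k d ms C' where
      "ls = pre @ k # ms" "ctx_path C1 pre C'" "active C'" "red f k d" "interpretation_of (fill C' d) ms"
      by blast
    moreover from this C1(2) have "ctx_path C (l # pre) C'" by (blast intro: ctx_path_Cons)
    ultimately show ?thesis by (metis append_Cons)
  qed
qed

text \<open>
  Here \<open>run\<close> lists the steps until just before the hole terminates, and \<open>pre\<close> those among them
  that take place outside the hole.
\<close>

lemma interpretation_last_step:
  assumes "interpretation_of (Stmt (plug C f)) ls" "solid f"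
  shows "\<exists>run pre l ms C'. ls = run @ l # ms \<and> ctx_path C pre C' \<and> active C' \<and>
    interpretation_of (fill C' Done) ms \<and> set (basics f) \<subseteq> insert l (set run)"
  using assms
proof (induction ls arbitrary: C f rule: list.induct)
  case Nil
  then show ?case by (simp add: interpretation_Stmt)
next
  case (Cons l ls)
  then obtain c where c: "red (plug C f) l c" "interpretation_of c ls"
    by (auto simp: interpretation_Stmt)
  from red_plug_cases[OF c(1) \<open>solid f\<close>] show ?case
  proof (elim disjE conjE exE)
    fix c' assume c': "active C" "red f l c'" "c = fill C c'"
    show ?thesis
    proof (cases c')
      case Done
      then have "set (basics f) \<subseteq> insert l (set [])" using red_basics[OF c'(2)] by simp
      with Done c' c(2) ctx_path_Nil show ?thesis by (metis append_Nil)
    next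
      \<comment> \<open>A step of the content enters \<open>run\<close> only: the context has not
        moved, so the path \<open>pre\<close> of the remaining run serves unchanged.\<close>
      case (Stmt f')
      have "solid f'" using red_solid c' Stmt \<open>solid f\<close> by blast
      have "interpretation_of (Stmt (plug C f')) ls" using c c' Stmt by simp
      from Cons.IH[OF this \<open>solid f'\<close>] obtain run pre k ms C' where IH:
        "ls = run @ k # ms" "ctx_path C pre C'" "active C'" "interpretation_of (fill C' Done) ms"
        "set (basics f') \<subseteq> insert k (set run)"
        by blast
      moreover have "set (basics f) \<subseteq> insert k (set (l # run))"
        using IH(5) red_basics[OF c'(2)] Stmt by auto
      ultimately show ?thesis by (metis append_Cons)
    qed
  next
    fix C1 assume C1: "c = Stmt (plug C1 f)" "ctx_step C l C1"
    from Cons.IH[OF c(2)[unfolded C1] \<open>solid f\<close>] obtain run pre k ms C' where IH: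
      "ls = run @ k # ms" "ctx_path C1 pre C'" "active C'" "interpretation_of (fill C' Done) ms"
      "set (basics f) \<subseteq> insert k (set run)"
      by blast
    moreover have "ctx_path C (l # pre) C'" using C1(2) IH(2) by (rule ctx_path_Cons)
    moreover have "set (basics f) \<subseteq> insert k (set (l # run))" using IH(5) by auto
    ultimately show ?thesis by (metis append_Cons)
  qed
qed

lemma interpretation_fill_append:
  assumes "interpretation_of c ms" "active C" "interpretation_of (fill C Done) ns"
  shows "interpretation_of (fill C c) (ms @ ns)"
  using assms
  by (induction rule: interpretation_of.induct) (auto intro: interpretation_of.intros red_fill)

text \<open>Context steps taken while the hole is active remain possible after its termination, by
  the second clause of \<open>ctx_step\<close>. The induction thus assigns each step to one of two
  independent runs.\<close>

lemma interpretation_shuffle: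
  assumes "interpretation_of (fill C c) ls" "active C" "case c of Stmt f \<Rightarrow> solid f | Done \<Rightarrow> True"
  shows "\<exists>ms ns. interpretation_of c ms \<and> interpretation_of (fill C Done) ns \<and> ls \<in> shuffles ms ns"
  using assms
proof (induction ls arbitrary: C c rule: list.induct)
  case Nil
  then show ?case by (cases c) (auto simp: interpretation_Stmt)
next
  case (Cons l ls)
  show ?case
  proof (cases c)
    case Done
    with Cons.prems show ?thesis by (intro exI[of _ "[]"] exI[of _ "l # ls"]) auto
  next
    case (Stmt f)
    with Cons.prems obtain d where d: "red (plug C f) l d" "interpretation_of d ls" and "solid f"
      by (auto simp: interpretation_Stmt)
    from red_plug_cases[OF d(1) \<open>solid f\<close>] show ?thesis
    proof (elim disjE conjE exE)
      fix c' assume c': "red f l c'" "d = fill C c'"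
      have "case c' of Stmt f \<Rightarrow> solid f | Done \<Rightarrow> True"
        using red_solid c' \<open>solid f\<close> by (cases c') auto
      from Cons.IH[OF d(2)[unfolded c'(2)] \<open>active C\<close> this] obtain ms ns where
        "interpretation_of c' ms" "interpretation_of (fill C Done) ns" "ls \<in> shuffles ms ns"
        by blast
      with c' Stmt show ?thesis
        by (intro exI[of _ "l # ms"] exI[of _ ns])
          (auto intro: interpretation_of.intros Cons_in_shuffles_leftI)
    next
      fix C1 assume C1: "d = Stmt (plug C1 f)" "ctx_step C l C1"
      then obtain s where s: "active C1" "fill C Done = Stmt s" "red s l (fill C1 Done)"
        using \<open>active C\<close> unfolding ctx_step_def by blast
      have "interpretation_of (fill C1 (Stmt f)) ls" using d C1 by simp
      from Cons.IH[OF this s(1)] \<open>solid f\<close> obtain ms ns where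
        "interpretation_of (Stmt f) ms" "interpretation_of (fill C1 Done) ns" "ls \<in> shuffles ms ns"
        by auto
      with s Stmt show ?thesis
        by (intro exI[of _ ms] exI[of _ "l # ns"])
          (auto intro: interpretation_of.intros Cons_in_shuffles_rightI)
    qed
  qed
qed

section \<open>The order of execution in lists of labels\<close>

lemma executed_before_Nil [simp]: "\<not> executed_before u v []"
  unfolding executed_before_def by simp

lemma executed_before_Cons [simp]:
  "executed_before u v (l # ls) \<longleftrightarrow> l = Some u \<and> Some v \<in> set ls \<or> executed_before u v ls"
proof
  assume "executed_before u v (l # ls)"
  then obtain i j where ij: "i < j" "j < length (l # ls)" "(l # ls) ! i = Some u" "(l # ls) ! j = Some v"
    unfolding executed_before_def by blast
  then obtain j' where j: "j = Suc j'" by (cases j) auto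
  show "l = Some u \<and> Some v \<in> set ls \<or> executed_before u v ls"
  proof (cases i)
    case 0
    with ij j show ?thesis by (auto simp: in_set_conv_nth)
  next
    case (Suc i')
    with ij j show ?thesis unfolding executed_before_def by auto
  qed
next
  assume "l = Some u \<and> Some v \<in> set ls \<or> executed_before u v ls"
  then show "executed_before u v (l # ls)"
  proof
    assume *: "l = Some u \<and> Some v \<in> set ls"
    then obtain j where "j < length ls" "ls ! j = Some v" by (auto simp: in_set_conv_nth)
    with * show ?thesis unfolding executed_before_def
      by (intro exI[of _ 0] exI[of _ "Suc j"]) auto
  next
    assume "executed_before u v ls"
    then obtain i j where "i < j" "j < length ls" "ls ! i = Some u" "ls ! j = Some v"
      unfolding executed_before_def by blast
    then show ?thesis unfolding executed_before_def
      by (intro exI[of _ "Suc i"] exI[of _ "Suc j"]) auto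
  qed
qed

lemma executed_before_append [simp]:
  "executed_before u v (ks @ ls) \<longleftrightarrow> executed_before u v ks \<or> executed_before u v ls \<or>
     Some u \<in> set ks \<and> Some v \<in> set ls"
  by (induction ks) auto

lemma executed_before_set: "executed_before u v ls \<Longrightarrow> Some u \<in> set ls \<and> Some v \<in> set ls"
  by (induction ls) auto

lemma executed_before_shuffles:
  "ls \<in> shuffles ms ns \<Longrightarrow> executed_before u v ms \<Longrightarrow> executed_before u v ls"
proof (induction ls arbitrary: ms ns)
  case (Cons l ls)
  from Cons.prems(1) consider ms' where "ms = l # ms'" "ls \<in> shuffles ms' ns"
    | ns' where "ls \<in> shuffles ms ns'"
    unfolding Cons_in_shuffles_iff by (metis list.collapse)
  then show ?case
  proof cases
    case 1
    with Cons show ?thesis by (auto simp: set_shuffles)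
  next
    case 2
    with Cons show ?thesis by auto
  qed
qed simp

section \<open>Happens-before in a plugged context\<close>

lemma is_finish_solid: "is_finish f \<Longrightarrow> solid f"
  by (cases f) auto

lemma ctx_path_labels: "ctx_path C pre C' \<Longrightarrow> Some a \<in> set pre \<Longrightarrow> Some a \<in> set (ctx_basics C)"
  unfolding ctx_path_def by auto

lemma interpretation_fill_Done_labels:
  assumes "ctx_path C pre C'" "interpretation_of (fill C' Done) ms" "Some a \<in> set ms"
  shows "Some a \<in> set (ctx_basics C)"
proof -
  have "Some a \<in> set (ctx_basics C')"
    using interpretation_basics[OF assms(2)] basics_fill_Done[of C'] assms(3) by auto
  then show ?thesis using assms(1) unfolding ctx_path_def by auto
qed

text \<open>Executes \<open>f\<close> in one uninterrupted block as soon as \<open>pre\<close> has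
  made the hole active.\<close>

lemma ctx_path_run:
  assumes "ctx_path C pre C'" "active C'" "solid f"
    "interpretation_of (Stmt f) ms" "interpretation_of (fill C' Done) ns"
  shows "interpretation_of (Stmt (plug C f)) (pre @ ms @ ns)"
  using assms interpretation_fill_append[OF assms(4,2,5)] unfolding ctx_path_def by auto

lemma interpretation_Basic: "interpretation_of (Stmt (Basic b)) [b]"
  by (auto simp: interpretation_Stmt red_Basic_iff)

text \<open>The split is made at the first step of \<open>f\<close>, because from there on the hole
  is known to be active.\<close>

lemma interpretation_hole_shuffle:
  assumes "interpretation_of (Stmt (plug C f)) ls" "solid f"
  shows "\<exists>pre l ms ns rest C'. ls = pre @ l # rest \<and> ctx_path C pre C' \<and> active C' \<and>
    interpretation_of (Stmt f) (l # ms) \<and> interpretation_of (fill C' Done) ns \<and> rest \<in> shuffles ms ns"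
proof -
  obtain pre l c rest C' where split: "ls = pre @ l # rest" "ctx_path C pre C'" "active C'"
    "red f l c" "interpretation_of (fill C' c) rest"
    using interpretation_first_step[OF assms] by blast
  have "case c of Stmt f \<Rightarrow> solid f | Done \<Rightarrow> True"
    using red_solid split(4) assms(2) by (cases c) auto
  from interpretation_shuffle[OF split(5,3) this] obtain ms ns where
    "interpretation_of c ms" "interpretation_of (fill C' Done) ns" "rest \<in> shuffles ms ns"
    by blast
  moreover from this have "interpretation_of (Stmt f) (l # ms)"
    using split(4) by (blast intro: interpretation_of.intros)
  ultimately show ?thesis using split(1-3) by blast
qed

lemma happens_before_plug_finish:
  assumes fin: "is_finish F" "is_finish (plug C F)"
    and fresh: "Some u \<notin> set (ctx_basics C)" "Some v \<notin> set (ctx_basics C)"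
  shows "happens_before (plug C F) u v \<longleftrightarrow> happens_before F u v"
proof
  assume hb: "happens_before (plug C F) u v"
  \<comment> \<open>Any run of the whole supplies surroundings \<open>pre\<close> and
    \<open>ns\<close> into which every run of \<open>F\<close> can be inserted.\<close>
  obtain ls where "interpretation_of (Stmt (plug C F)) ls"
    using interpretation_exists fin by blast
  from interpretation_hole_shuffle[OF this is_finish_solid[OF fin(1)]] obtain pre C' ns where
    C': "ctx_path C pre C'" "active C'" "interpretation_of (fill C' Done) ns"
    by blast
  show "happens_before F u v" unfolding happens_before_def
  proof (intro allI impI)
    fix ms assume "interpretation_of (Stmt F) ms"
    from ctx_path_run[OF C'(1,2) is_finish_solid[OF fin(1)] this C'(3)] hb
    have "executed_before u v (pre @ ms @ ns)" unfolding happens_before_def by blast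
    moreover have "Some u \<notin> set pre" "Some v \<notin> set ns" "Some u \<notin> set ns"
      using fresh ctx_path_labels[OF C'(1)] interpretation_fill_Done_labels[OF C'(1,3)] by blast+
    ultimately show "executed_before u v ms"
      using executed_before_set[of u v pre] executed_before_set[of u v ns] by auto
  qed
next
  assume hb: "happens_before F u v"
  show "happens_before (plug C F) u v" unfolding happens_before_def
  proof (intro allI impI)
    fix ls assume "interpretation_of (Stmt (plug C F)) ls"
    from interpretation_hole_shuffle[OF this is_finish_solid[OF fin(1)]] obtain pre l ms ns rest where
      run: "ls = pre @ l # rest" "interpretation_of (Stmt F) (l # ms)" "rest \<in> shuffles ms ns"
      by blast
    have "executed_before u v (l # ms)" using hb run(2) unfolding happens_before_def by blast
    then show "executed_before u v ls"
      using run(1) executed_before_shuffles[OF run(3)] set_shuffles[OF run(3)] by auto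
  qed
qed

text \<open>The single step of \<open>Basic (Some U)\<close> marks a place where the hole is active;
  there some run of \<open>f\<close> is inserted in its stead.\<close>

lemma collapsed_run:
  assumes "is_finish f" "interpretation_of (Stmt (plug C (Basic (Some U)))) ls"
  shows "\<exists>pre ms ns. ls = pre @ Some U # ns \<and> interpretation_of (Stmt f) ms \<and>
    interpretation_of (Stmt (plug C f)) (pre @ ms @ ns) \<and>
    (\<forall>a. Some a \<in> set pre \<union> set ns \<longrightarrow> Some a \<in> set (ctx_basics C))"
proof -
  obtain ms where ms: "interpretation_of (Stmt f) ms" using interpretation_exists assms by blast
  obtain pre ns C' where C': "ls = pre @ Some U # ns" "ctx_path C pre C'" "active C'"
    "interpretation_of (fill C' Done) ns"
    using interpretation_first_step[OF assms(2)] by (auto simp: red_Basic_iff)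
  show ?thesis
    using C'(1) ms ctx_path_run[OF C'(2,3) is_finish_solid[OF assms(1)] ms C'(4)]
      ctx_path_labels[OF C'(2)] interpretation_fill_Done_labels[OF C'(2,4)]
    by (intro exI[of _ pre] exI[of _ ms] exI[of _ ns]) auto
qed

text \<open>
  To collapse \<open>f\<close> in a run where \<open>x\<close> does not precede \<open>y\<close>, let \<open>U\<close> replace the last step of \<open>f\<close>;
  in a run where \<open>y\<close> does not precede \<open>x\<close>, let it replace the first one.
\<close>

lemma happens_before_collapse_left:
  assumes "is_finish f" "Some x \<in> set (basics f)" "Some x \<notin> set (ctx_basics C)"
    "Some y \<notin> set (basics f)" "Some U \<notin> set (ctx_basics C)" "U \<noteq> y"
  shows "happens_before (plug C f) x y \<longleftrightarrow> happens_before (plug C (Basic (Some U))) U y"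
proof
  assume hb: "happens_before (plug C f) x y"
  show "happens_before (plug C (Basic (Some U))) U y" unfolding happens_before_def
  proof (intro allI impI)
    fix ls assume "interpretation_of (Stmt (plug C (Basic (Some U)))) ls"
    from collapsed_run[OF assms(1) this] obtain pre ms ns where
      run: "ls = pre @ Some U # ns" "interpretation_of (Stmt f) ms"
      "interpretation_of (Stmt (plug C f)) (pre @ ms @ ns)"
      "\<forall>a. Some a \<in> set pre \<union> set ns \<longrightarrow> Some a \<in> set (ctx_basics C)"
      by blast
    \<comment> \<open>\<open>x\<close> is executed only in \<open>ms\<close> and \<open>y\<close>
      only outside it, so \<open>y\<close> lies in \<open>ns\<close>, after
      \<open>U\<close>.\<close>
    have "Some x \<notin> set pre \<union> set ns" using run(4) assms(3) by blast
    moreover have "Some y \<notin> set ms" using interpretation_basics[OF run(2)] assms(4) by auto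
    moreover have "executed_before x y (pre @ ms @ ns)"
      using hb run(3) unfolding happens_before_def by blast
    ultimately show "executed_before U y ls"
      using run(1) by (auto dest: executed_before_set)
  qed
next
  assume hb: "happens_before (plug C (Basic (Some U))) U y"
  show "happens_before (plug C f) x y" unfolding happens_before_def
  proof (intro allI impI)
    fix ls assume "interpretation_of (Stmt (plug C f)) ls"
    from interpretation_last_step[OF this is_finish_solid[OF assms(1)]] obtain run pre l ns C' where
      run: "ls = run @ l # ns" "ctx_path C pre C'" "active C'" "interpretation_of (fill C' Done) ns"
      "set (basics f) \<subseteq> insert l (set run)"
      by blast
    have "interpretation_of (Stmt (plug C (Basic (Some U)))) (pre @ [Some U] @ ns)"
      using ctx_path_run[OF run(2,3) _ interpretation_Basic run(4)] by simp
    with hb have "executed_before U y (pre @ [Some U] @ ns)" unfolding happens_before_def by blast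
    moreover have "Some U \<notin> set pre" using ctx_path_labels[OF run(2)] assms(5) by blast
    \<comment> \<open>Hence \<open>y\<close> comes after the last step of \<open>f\<close>, whereas
      \<open>x\<close> is executed at that step or earlier.\<close>
    ultimately have "Some y \<in> set ns" using \<open>U \<noteq> y\<close> by (auto dest: executed_before_set)
    with assms(2) run(1,5) show "executed_before x y ls" by auto
  qed
qed

lemma happens_before_collapse_right:
  assumes "is_finish f" "Some x \<in> set (basics f)" "Some x \<notin> set (ctx_basics C)"
    "Some y \<notin> set (basics f)" "Some U \<notin> set (ctx_basics C)" "U \<noteq> y"
  shows "happens_before (plug C f) y x \<longleftrightarrow> happens_before (plug C (Basic (Some U))) y U"
proof
  assume hb: "happens_before (plug C f) y x"
  show "happens_before (plug C (Basic (Some U))) y U" unfolding happens_before_def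
  proof (intro allI impI)
    fix ls assume "interpretation_of (Stmt (plug C (Basic (Some U)))) ls"
    from collapsed_run[OF assms(1) this] obtain pre ms ns where
      run: "ls = pre @ Some U # ns" "interpretation_of (Stmt f) ms"
      "interpretation_of (Stmt (plug C f)) (pre @ ms @ ns)"
      "\<forall>a. Some a \<in> set pre \<union> set ns \<longrightarrow> Some a \<in> set (ctx_basics C)"
      by blast
    have "Some x \<notin> set pre \<union> set ns" using run(4) assms(3) by blast
    moreover have "Some y \<notin> set ms" using interpretation_basics[OF run(2)] assms(4) by auto
    moreover have "executed_before y x (pre @ ms @ ns)"
      using hb run(3) unfolding happens_before_def by blast
    ultimately show "executed_before y U ls"
      using run(1) by (auto dest: executed_before_set)
  qed
next
  assume hb: "happens_before (plug C (Basic (Some U))) y U"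
  show "happens_before (plug C f) y x" unfolding happens_before_def
  proof (intro allI impI)
    fix ls assume "interpretation_of (Stmt (plug C f)) ls"
    from interpretation_hole_shuffle[OF this is_finish_solid[OF assms(1)]] obtain pre l ms ns rest C' where
      run: "ls = pre @ l # rest" "ctx_path C pre C'" "active C'" "interpretation_of (Stmt f) (l # ms)"
      "interpretation_of (fill C' Done) ns" "rest \<in> shuffles ms ns"
      by blast
    have "interpretation_of (Stmt (plug C (Basic (Some U)))) (pre @ [Some U] @ ns)"
      using ctx_path_run[OF run(2,3) _ interpretation_Basic run(5)] by simp
    with hb have "executed_before y U (pre @ [Some U] @ ns)" unfolding happens_before_def by blast
    moreover have "Some U \<notin> set pre" using ctx_path_labels[OF run(2)] assms(5) by blast
    moreover have "Some U \<notin> set ns" using interpretation_fill_Done_labels[OF run(2,5)] assms(5) by blast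
    \<comment> \<open>\<open>U\<close> occurs only at the contracted step, so \<open>y\<close> is
      executed before \<open>f\<close> starts, and thus before \<open>x\<close>.\<close>
    ultimately have "Some y \<in> set pre" using \<open>U \<noteq> y\<close> by (auto dest: executed_before_set)
    moreover have "Some x \<in> set (l # ms)" using interpretation_basics[OF run(4)] assms(2) by auto
    ultimately show "executed_before y x ls" using run(1) set_shuffles[OF run(6)] by auto
  qed
qed

section \<open>Substatements and replacement\<close>

lemma substmts_refl [simp]: "s \<in> substmts s"
  by (cases s) auto

lemma substmts_basics: "f \<in> substmts s \<Longrightarrow> set (basics f) \<subseteq> set (basics s)"
  by (induction s) auto

lemma substmts_plug: "f \<in> substmts s \<Longrightarrow> \<exists>C. s = plug C f"
proof (induction s)
  case (Seq s t)
  then consider "f = Seq s t" | "\<exists>C. s = plug C f" | "\<exists>C. t = plug C f" by auto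
  then show ?case by cases (metis plug.simps)+
next
  case (Async s)
  then consider "f = Async s" | "\<exists>C. s = plug C f" by auto
  then show ?case by cases (metis plug.simps)+
next
  case (Finish s)
  then consider "f = Finish s" | "\<exists>C. s = plug C f" by auto
  then show ?case by cases (metis plug.simps)+
qed (metis plug.simps(1) singletonD substmts.simps)+

lemma plug_in_substmts: "f \<in> substmts (plug C f)"
  by (induction C) auto

text \<open>\<open>replace\<close> compares each enclosing statement with \<open>f\<close> before
  descending; a comparison of sizes shows that these tests fail above the hole.\<close>

lemma plug_eq_self: "plug C f = f \<Longrightarrow> C = Hole"
proof -
  have "size f < size (plug C f)" if "C \<noteq> Hole"
    using that
  proof (induction C)
    case (Seq_L C t) then show ?case by (cases "C = Hole") auto
  next
    case (Seq_R s C) then show ?case by (cases "C = Hole") auto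
  next
    case (Async_C C) then show ?case by (cases "C = Hole") auto
  next
    case (Finish_C C) then show ?case by (cases "C = Hole") auto
  qed simp
  then show "plug C f = f \<Longrightarrow> C = Hole" by (metis less_irrefl)
qed

lemma replace_id: "f \<notin> substmts s \<Longrightarrow> replace f b s = s"
  by (induction s) (subst replace.simps; auto)+

text \<open>The name \<open>a\<close> identifies the occurrence: the context lacks it, so
  \<open>f\<close> cannot occur beside the hole.\<close>

lemma replace_plug:
  assumes "Some a \<in> set (basics f)" "Some a \<notin> set (ctx_basics C)"
  shows "replace f b (plug C f) = plug C (Basic (Some b))"
  using assms(2)
proof (induction C)
  case Hole
  then show ?case by (subst replace.simps) simp
next
  case (Seq_L C t)
  then have "f \<notin> substmts t" using substmts_basics assms(1) by fastforce
  with Seq_L plug_eq_self[of "Seq_L C t" f] show ?case by (subst replace.simps) (auto simp: replace_id)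
next
  case (Seq_R s C)
  then have "f \<notin> substmts s" using substmts_basics assms(1) by fastforce
  with Seq_R plug_eq_self[of "Seq_R s C" f] show ?case by (subst replace.simps) (auto simp: replace_id)
next
  case (Async_C C)
  with plug_eq_self[of "Async_C C" f] show ?case by (subst replace.simps) auto
next
  case (Finish_C C)
  with plug_eq_self[of "Finish_C C" f] show ?case by (subst replace.simps) auto
qed

text \<open>Every statement on the way to the hole contains \<open>f\<close>, so \<open>g\<close>
  lies beside the hole. Thus \<open>fv\<close> survives the contraction of
  \<open>fu\<close>.\<close>

lemma substmts_plug_disjoint:
  assumes "g \<in> substmts (plug C f)" "f \<notin> substmts g" "g \<notin> substmts f"
  shows "g \<in> substmts (plug C h)"
  using assms
proof (induction C)
  case (Seq_L C t)
  then show ?case using plug_in_substmts[of f "Seq_L C t"] by auto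
next
  case (Seq_R s C)
  then show ?case using plug_in_substmts[of f "Seq_R s C"] by auto
next
  case (Async_C C)
  then show ?case using plug_in_substmts[of f "Async_C C"] by auto
next
  case (Finish_C C)
  then show ?case using plug_in_substmts[of f "Finish_C C"] by auto
qed auto

section \<open>Passage to the innermost finish and contraction of its inner finishes\<close>

lemma outermost_inner_finishE:
  assumes "outermost_inner_finish F u fu" "fu \<noteq> F"
  shows "is_finish fu" "fu \<in> substmts F" "u \<in> ops fu"
  using assms unfolding outermost_inner_finish_def inner_finishes_def finishes_def
  by (auto split: if_splits)

lemma innermost_finish_notin:
  assumes "innermost_finish p u v F" "f \<in> substmts F" "is_finish f" "f \<noteq> F" "u \<in> ops f"
  shows "v \<notin> ops f"
  using assms unfolding innermost_finish_def finishes_def by blast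

theorem mainTheorem3:
  fixes p F fu fv :: "'a stmt" and u v U V :: 'a
  assumes "program p"
    and "u \<in> ops p" and "v \<in> ops p" and "u \<noteq> v"
    and "innermost_finish p u v F"
    and "outermost_inner_finish F u fu"
    and "outermost_inner_finish F v fv"
    and "if fu = F then U = u else U \<notin> ops p"
    and "if fv = F then V = v else V \<notin> ops p"
    and "U \<noteq> V"
  shows "happens_before p u v \<longleftrightarrow>
    happens_before (replace_inner F fv V (replace_inner F fu U F)) U V"
proof -
  have F: "is_finish F" "F \<in> substmts p" "u \<in> ops F" "v \<in> ops F"
    using assms(5) unfolding innermost_finish_def finishes_def by auto
  obtain C where C: "p = plug C F" using substmts_plug F(2) by blast
  have p: "is_finish p" "distinct (basics p)" using assms(1) unfolding program_def by auto
  have distinct_F: "distinct (basics F)" and "set (ctx_basics C) \<inter> set (basics F) = {}"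
    using p(2) unfolding C distinct_basics_plug by auto
  \<comment> \<open>Names are distinct and \<open>F\<close> contains both \<open>u\<close> and
    \<open>v\<close>, so the context of \<open>F\<close> contains neither.\<close>
  then have "happens_before p u v \<longleftrightarrow> happens_before F u v"
    using happens_before_plug_finish[OF F(1), of C u v] p(1) F(3,4)
    unfolding C ops_iff_basics by blast
  moreover
  have F_p: "Some a \<in> set (basics p)" if "Some a \<in> set (basics F)" for a
    using that substmts_basics[OF F(2)] by blast
  define F1 where "F1 = replace_inner F fu U F"
  have fv_u: "u \<notin> ops fv" if "fv \<noteq> F"
    using innermost_finish_notin[OF assms(5)] outermost_inner_finishE[OF assms(7) that] that by blast
  have fu_v: "v \<notin> ops fu" if "fu \<noteq> F"
    using innermost_finish_notin[OF assms(5)] outermost_inner_finishE[OF assms(6) that] that by blast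
  \<comment> \<open>First contraction. Distinct names and the survival of \<open>fv\<close> are
    recorded for the second one; if \<open>fu = F\<close>, nothing changes and \<open>U\<close> is
    \<open>u\<close>.\<close>
  have F1: "(happens_before F u v \<longleftrightarrow> happens_before F1 U v) \<and> distinct (basics F1) \<and>
      set (basics F1) \<subseteq> insert (Some U) (set (basics F)) \<and> (fv \<noteq> F \<longrightarrow> fv \<in> substmts F1)"
  proof (cases "fu = F")
    case True
    then show ?thesis
      using assms(8) distinct_F outermost_inner_finishE(2)[OF assms(7)]
      unfolding F1_def replace_inner_def by auto
  next
    case False
    note fu = outermost_inner_finishE[OF assms(6) False]
    have U: "Some U \<notin> set (basics F)" "U \<noteq> v"
      using assms(3,8) False F_p ops_iff_basics by metis+
    obtain D where D: "F = plug D fu" using substmts_plug fu(2) by blast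
    have dist: "distinct (ctx_basics D)" "set (ctx_basics D) \<inter> set (basics fu) = {}"
      and sub: "set (basics F) = set (ctx_basics D) \<union> set (basics fu)"
      using distinct_F unfolding D distinct_basics_plug set_basics_plug by auto
    have u: "Some u \<in> set (basics fu)" "Some u \<notin> set (ctx_basics D)" "Some v \<notin> set (basics fu)"
      using fu(3) fu_v[OF False] dist ops_iff_basics by fastforce+
    have F1: "F1 = plug D (Basic (Some U))"
      using replace_plug[OF u(1,2)] False unfolding F1_def replace_inner_def D[symmetric] by simp
    have "happens_before F u v \<longleftrightarrow> happens_before F1 U v"
      unfolding F1 using U sub by (subst D, intro happens_before_collapse_left[OF fu(1) u]) auto
    moreover have "distinct (basics F1)" "set (basics F1) \<subseteq> insert (Some U) (set (basics F))"
      using dist U sub unfolding F1 distinct_basics_plug set_basics_plug by auto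
    moreover have "fv \<in> substmts F1" if "fv \<noteq> F"
    proof -
      note fv = outermost_inner_finishE[OF assms(7) that]
      \<comment> \<open>Each of the two finishes contains an operation that the other lacks.\<close>
      have "fu \<notin> substmts fv" "fv \<notin> substmts fu"
        using substmts_basics fu(3) fv(3) fv_u[OF that] fu_v[OF False] ops_iff_basics by (metis subsetD)+
      then show ?thesis using substmts_plug_disjoint fv(2) D F1 by metis
    qed
    ultimately show ?thesis by blast
  qed
  have "happens_before F1 U v \<longleftrightarrow> happens_before (replace_inner F fv V F1) U V"
  proof (cases "fv = F")
    case True
    then show ?thesis using assms(9) unfolding replace_inner_def by simp
  next
    case False
    note fv = outermost_inner_finishE[OF assms(7) False]
    have V: "Some V \<notin> set (basics F1)"
      using assms(9,10) False F1 F_p ops_iff_basics by (metis insert_iff option.inject subsetD)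
    \<comment> \<open>\<open>U\<close> is \<open>u\<close>, which \<open>fv\<close> does not
      contain, or else a name foreign to \<open>p\<close>.\<close>
    have U: "Some U \<notin> set (basics fv)"
      using assms(8) fv_u[OF False] F_p substmts_basics[OF fv(2)] ops_iff_basics by (metis subsetD)
    obtain D where D: "F1 = plug D fv" using substmts_plug F1 False by blast
    have dist: "set (ctx_basics D) \<inter> set (basics fv) = {}"
      and sub: "set (basics F1) = set (ctx_basics D) \<union> set (basics fv)"
      using F1 unfolding D distinct_basics_plug set_basics_plug by auto
    have v: "Some v \<in> set (basics fv)" "Some v \<notin> set (ctx_basics D)"
      using fv(3) dist ops_iff_basics by fastforce+
    have "replace_inner F fv V F1 = plug D (Basic (Some V))"
      using replace_plug[OF v] False unfolding replace_inner_def D by simp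
    then show ?thesis
      using V sub assms(10) by (simp add: D) (intro happens_before_collapse_right[OF fv(1) v U]; auto)
  qed
  ultimately show ?thesis using F1 unfolding F1_def by blast
qed

end
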